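(* Let $K\ge 0$ be an integer. Let $G_1,\ldots,G_n$ be nondeterministic automata, where $G_i$ has set of secret states $Q_i^S$, and consider the composed system $G_1\|\cdots\|G_n$ with interaction $\|_\lor$, i.e. with set of non-secret states $Q_1^{NS}\times\cdots\times Q_n^{NS}$ ($Q_i^{NS}=Q_i\setminus Q_i^S$) and all other states secret. For $1\le i\le n$ let $H_i$ be the two-way observer of $G_i$ with event set $\Sigma_{H_i}=\Delta(\Sigma_i)\cup\Delta_R(\Sigma_i)$, let $P_{i,\Delta}:\Sigma_{H_i}^*\to\Delta_R(\Sigma_i)^*$ be the natural projection, and let $H_{i,\psi_i}$ be the $\psi_i$-automaton of $H_i$ with set of $\psi_i$-states $X^i_{\psi_i}=\{(X^i,X^i_R): H_i\stackrel{s}{\to}(X^i,X^i_R)\text{ for some } s \text{ with } |P_{i,\Delta}(s)|\le K,\ X^i\cap X^i_R\subseteq Q_i^S,\ X^i\cap X^i_R\neq\emptyset\}$, where $\psi_1,\ldots,\psi_n$ are pairwise distinct new events. If $H_{1,\psi_1}\|\cdots\|H_{n,\psi_n}$ is nonblocking, then $G_1\|\cdots\|G_n$ is $K$-step opaque.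
   Context: An automaton is $G=\langle\Sigma_\tau,Q,\to,Q^\circ\rangle$ with finite set $\Sigma$ of observable events, a special unobservable event $\tau\notin\Sigma$, $\Sigma_\tau=\Sigma\cup\{\tau\}$, finite states $Q$, transitions $\to\subseteq Q\times\Sigma_\tau\times Q$, initial states $Q^\circ$, possibly marked states, and secret states $Q^S\subseteq Q$, $Q^{NS}=Q\setminus Q^S$. For $s\in\Sigma^*$, $p\stackrel{s}{\Rightarrow}q$ means there is $t\in\Sigma_\tau^*$ which becomes $s$ after deleting all $\tau$'s and $p\stackrel{t}{\to}q$; $p\stackrel{s}{\Rightarrow}$ means this for some $q$; $L(G,q)=\{s:q\stackrel{s}{\Rightarrow}\}$. Synchronous composition: states are tuples, initial (resp. marked) states are products of initial (resp. marked) states; a shared event (other than $\tau$, never shared) is executed jointly by all components having it in their alphabet; other events are executed by a single component while the others stay put. $K$-step opacity: $G$ is $K$-step opaque w.r.t. $Q^S$ iff for every $q^\circ\in Q^\circ$ and all $s,t\in\Sigma^*$ with $st\in L(G,q^\circ)$, $q^\circ\stackrel{s}{\Rightarrow}Q^S$ and $|t|\le K$, there exist $q'^\circ\in Q^\circ$ and $y\in Q^{NS}$ with $q'^\circ\stackrel{s}{\Rightarrow}y$ and $y\stackrel{t}{\Rightarrow}$. Reversed automaton: $G_R=\langle\Sigma_\tau,Q,\to_R,Q\rangle$ with $(x,\sigma,y)\in\to_R$ iff $y\stackrel{\sigma}{\to}x$, all states initial. Current-state estimator: $UR(B)$ is the set of states reachable from $B$ by strings in $\{\tau\}^*$; $det(G)$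 is the deterministic automaton over $\Sigma$ with initial state $UR(Q^\circ)$ and transitions $X\stackrel{\sigma}{\to}Y$ where $Y=\bigcup\{UR(\{y\}): x\stackrel{\sigma}{\to}y, x\in X\}$ is nonempty; only reachable states are kept. Two-way observer: with renamings $\Delta(\sigma)=(\sigma,\epsilon)$, $\Delta_R(\sigma)=(\epsilon,\sigma)$ relabelling transitions, $H_i=\Delta(det(G_i))\|\Delta_R(det(G_{i,R}))$, a deterministic automaton over $\Delta(\Sigma_i)\cup\Delta_R(\Sigma_i)$ with reachable states $(X^i,X^i_R)$, $X^i,X^i_R\subseteq Q_i$. $\psi$-automaton: for a deterministic automaton $D=\langle\Sigma,Q_D,\to,q^\circ\rangle$, set $X_\psi\subseteq Q_D$ and new event $\psi$, $D_\psi=\langle\Sigma\cup\{\psi\},Q_D\cup\{\bot\},\to\cup\{(x,\psi,\bot):x\in X_\psi\},q^\circ,Q_D\rangle$, with $\bot$ a new unmarked state and all original states marked. An automaton is nonblocking if from every reachable state some marked state is reachable. *)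

theory Defs
  imports Main "HOL-Library.FuncSet"
begin

text \<open>The unobservable event \<open>\<tau>\<close> is \<^term>\<open>None\<close>, an observable event \<open>\<sigma>\<close> is \<open>Some \<sigma>\<close>;
  \<open>events\<close> is \<open>\<Sigma>\<close>, without \<open>\<tau>\<close>.\<close>

record ('q, 'e) automaton =
  events :: "'e set"
  states :: "'q set"
  transitions :: "('q \<times> 'e option \<times> 'q) set"
  initial :: "'q set"
  marked :: "'q set"

definition wf_automaton :: "('q, 'e) automaton \<Rightarrow> bool" where
  "wf_automaton G \<longleftrightarrow>
     finite (events G) \<and> finite (states G) \<and>
     transitions G \<subseteq> states G \<times> insert None (Some ` events G) \<times> states G \<and>
     initial G \<subseteq> states G \<and> marked G \<subseteq> states G"

fun path :: "('q, 'e) automaton \<Rightarrow> 'q \<Rightarrow> 'e option list \<Rightarrow> 'q \<Rightarrow> bool" where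
  "path G p [] q \<longleftrightarrow> p = q"
| "path G p (a # t) q \<longleftrightarrow> (\<exists>r. (p, a, r) \<in> transitions G \<and> path G r t q)"

definition delete_tau :: "'e option list \<Rightarrow> 'e list" where
  "delete_tau t = map the (filter (\<lambda>a. a \<noteq> None) t)"

definition weak_path :: "('q, 'e) automaton \<Rightarrow> 'q \<Rightarrow> 'e list \<Rightarrow> 'q \<Rightarrow> bool" where
  "weak_path G p s q \<longleftrightarrow> (\<exists>t. delete_tau t = s \<and> path G p t q)"

definition lang :: "('q, 'e) automaton \<Rightarrow> 'q \<Rightarrow> 'e list set" where
  "lang G q = {s. \<exists>r. weak_path G q s r}"

definition reachable :: "('q, 'e) automaton \<Rightarrow> 'q set" where
  "reachable G = {q. \<exists>p\<in>initial G. \<exists>t. path G p t q}"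

definition accessible_part :: "('q, 'e) automaton \<Rightarrow> ('q, 'e) automaton" where
  "accessible_part G =
     \<lparr>events = events G,
      states = states G \<inter> reachable G,
      transitions = {(x, a, y) \<in> transitions G. x \<in> reachable G \<and> y \<in> reachable G},
      initial = initial G,
      marked = marked G \<inter> reachable G\<rparr>"

definition nonblocking :: "('q, 'e) automaton \<Rightarrow> bool" where
  "nonblocking G \<longleftrightarrow> (\<forall>q\<in>reachable G. \<exists>m\<in>marked G. \<exists>t. path G q t m)"

text \<open>Synchronous composition of a family indexed by \<open>I\<close>; tuples are the extensional
  functions on \<open>I\<close>. An event belonging to the alphabet of only one component is covered by
  the first set of transitions.\<close>

definition sync :: "'i set \<Rightarrow> ('i \<Rightarrow> ('q, 'e) automaton) \<Rightarrow> ('i \<Rightarrow> 'q, 'e) automaton" where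
  "sync I G =
     \<lparr>events = (\<Union>i\<in>I. events (G i)),
      states = (\<Pi>\<^sub>E i\<in>I. states (G i)),
      transitions =
        {(x, Some \<sigma>, y) | x \<sigma> y.
           x \<in> (\<Pi>\<^sub>E i\<in>I. states (G i)) \<and> y \<in> (\<Pi>\<^sub>E i\<in>I. states (G i)) \<and>
           \<sigma> \<in> (\<Union>i\<in>I. events (G i)) \<and>
           (\<forall>i\<in>I. if \<sigma> \<in> events (G i) then (x i, Some \<sigma>, y i) \<in> transitions (G i)
                  else y i = x i)} \<union>
        {(x, None, x(i := q)) | x i q.
           x \<in> (\<Pi>\<^sub>E i\<in>I. states (G i)) \<and> i \<in> I \<and> (x i, None, q) \<in> transitions (G i)},
      initial = (\<Pi>\<^sub>E i\<in>I. initial (G i)),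
      marked = (\<Pi>\<^sub>E i\<in>I. marked (G i))\<rparr>"

text \<open>The same composition for two automata, whose state types may differ.\<close>

definition sync2 ::
  "('p, 'e) automaton \<Rightarrow> ('q, 'e) automaton \<Rightarrow> ('p \<times> 'q, 'e) automaton" where
  "sync2 A B =
     \<lparr>events = events A \<union> events B,
      states = states A \<times> states B,
      transitions =
        {((x, y), Some \<sigma>, (x', y')) | x y \<sigma> x' y'.
           x \<in> states A \<and> x' \<in> states A \<and> y \<in> states B \<and> y' \<in> states B \<and>
           \<sigma> \<in> events A \<union> events B \<and>
           (if \<sigma> \<in> events A then (x, Some \<sigma>, x') \<in> transitions A else x' = x) \<and>
           (if \<sigma> \<in> events B then (y, Some \<sigma>, y') \<in> transitions B else y' = y)} \<union>
        {((x, y), None, (x', y)) | x y x'. (x, None, x') \<in> transitions A \<and> y \<in> states B} \<union>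
        {((x, y), None, (x, y')) | x y y'. x \<in> states A \<and> (y, None, y') \<in> transitions B},
      initial = initial A \<times> initial B,
      marked = marked A \<times> marked B\<rparr>"

definition k_step_opaque :: "nat \<Rightarrow> ('q, 'e) automaton \<Rightarrow> 'q set \<Rightarrow> bool" where
  "k_step_opaque K G QS \<longleftrightarrow>
     (\<forall>q0\<in>initial G. \<forall>s\<in>lists (events G). \<forall>t\<in>lists (events G).
        s @ t \<in> lang G q0 \<and> (\<exists>x\<in>QS. weak_path G q0 s x) \<and> length t \<le> K \<longrightarrow>
        (\<exists>q0'\<in>initial G. \<exists>y\<in>states G - QS.
           weak_path G q0' s y \<and> (\<exists>z. weak_path G y t z)))"

text \<open>Secret states of a composition under the interaction \<open>\<parallel>\<^sub>\<or>\<close>.\<close>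

definition secret_or :: "'i set \<Rightarrow> ('i \<Rightarrow> ('q, 'e) automaton) \<Rightarrow> ('i \<Rightarrow> 'q set) \<Rightarrow> ('i \<Rightarrow> 'q) set"
  where "secret_or I G QS = states (sync I G) - (\<Pi>\<^sub>E i\<in>I. states (G i) - QS i)"

text \<open>Reversed automata and current-state estimators carry no marking: their set of marked
  states is left empty, and the \<open>\<psi>\<close>-automaton below introduces its own marking.\<close>

definition reversed :: "('q, 'e) automaton \<Rightarrow> ('q, 'e) automaton" where
  "reversed G =
     \<lparr>events = events G, states = states G,
      transitions = {(x, a, y). (y, a, x) \<in> transitions G},
      initial = states G, marked = {}\<rparr>"

definition unobservable_reach :: "('q, 'e) automaton \<Rightarrow> 'q set \<Rightarrow> 'q set" where
  "unobservable_reach G B = {q. \<exists>p\<in>B. \<exists>k. path G p (replicate k None) q}"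

definition estimate_step :: "('q, 'e) automaton \<Rightarrow> 'q set \<Rightarrow> 'e \<Rightarrow> 'q set" where
  "estimate_step G X \<sigma> =
     \<Union>{unobservable_reach G {y} | x y. x \<in> X \<and> (x, Some \<sigma>, y) \<in> transitions G}"

definition det :: "('q, 'e) automaton \<Rightarrow> ('q set, 'e) automaton" where
  "det G = accessible_part
     \<lparr>events = events G,
      states = Pow (states G),
      transitions = {(X, Some \<sigma>, Y) | X \<sigma> Y.
        X \<subseteq> states G \<and> \<sigma> \<in> events G \<and> Y = estimate_step G X \<sigma> \<and> Y \<noteq> {}},
      initial = {unobservable_reach G (initial G)},
      marked = {}\<rparr>"

definition relabel :: "('e \<Rightarrow> 'f) \<Rightarrow> ('q, 'e) automaton \<Rightarrow> ('q, 'f) automaton" where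
  "relabel f G =
     \<lparr>events = f ` events G, states = states G,
      transitions = {(x, map_option f a, y) | x a y. (x, a, y) \<in> transitions G},
      initial = initial G, marked = marked G\<rparr>"

text \<open>Pairs of words of length at most one; \<^term>\<open>[]\<close> is \<open>\<epsilon>\<close>.\<close>

definition Delta :: "'e \<Rightarrow> 'e list \<times> 'e list" where
  "Delta \<sigma> = ([\<sigma>], [])"

definition Delta_R :: "'e \<Rightarrow> 'e list \<times> 'e list" where
  "Delta_R \<sigma> = ([], [\<sigma>])"

definition two_way_observer ::
  "('q, 'e) automaton \<Rightarrow> ('q set \<times> 'q set, 'e list \<times> 'e list) automaton" where
  "two_way_observer G = sync2 (relabel Delta (det G)) (relabel Delta_R (det (reversed G)))"

definition natural_projection :: "'e set \<Rightarrow> 'e list \<Rightarrow> 'e list" where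
  "natural_projection A s = filter (\<lambda>e. e \<in> A) s"

text \<open>The new event \<open>\<psi>\<close> is made distinct from all events of \<open>D\<close> by passing to a sum type
  (\<open>Inl\<close> for events of \<open>D\<close>, \<open>Inr\<close> for \<open>\<psi>\<close>); the new state \<open>\<bottom>\<close> is \<^term>\<open>None\<close>.\<close>

definition psi_automaton ::
  "('q, 'e) automaton \<Rightarrow> 'q set \<Rightarrow> 'p \<Rightarrow> ('q option, 'e + 'p) automaton" where
  "psi_automaton D X\<psi> \<psi> =
     \<lparr>events = insert (Inr \<psi>) (Inl ` events D),
      states = insert None (Some ` states D),
      transitions =
        {(Some x, map_option Inl a, Some y) | x a y. (x, a, y) \<in> transitions D} \<union>
        {(Some x, Some (Inr \<psi>), None) | x. x \<in> X\<psi>},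
      initial = Some ` initial D,
      marked = Some ` states D\<rparr>"

definition psi_states ::
  "nat \<Rightarrow> ('q, 'e) automaton \<Rightarrow> 'q set \<Rightarrow> ('q set \<times> 'q set) set" where
  "psi_states K G QS =
     {(X, XR).
        (\<exists>h0\<in>initial (two_way_observer G). \<exists>s\<in>lists (events (two_way_observer G)).
           path (two_way_observer G) h0 (map Some s) (X, XR) \<and>
           length (natural_projection (Delta_R ` events G) s) \<le> K) \<and>
        X \<inter> XR \<subseteq> QS \<and> X \<inter> XR \<noteq> {}}"

end

theory Submission imports Defs begin

text \<open>Put \<open>s\<^sub>i\<close>, \<open>t\<^sub>i\<close> for the projections of \<open>s\<close>, \<open>t\<close> to \<open>\<Sigma>\<^sub>i\<close>. After the word
  \<open>\<Delta>(s) \<Delta>\<^sub>R(rev t)\<close> the composed two-way observers reach the state whose \<open>i\<close>-th component is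
  \<open>(X\<^sup>i, X\<^sup>i\<^sub>R)\<close>, where \<open>X\<^sup>i\<close> is the set of states of \<open>G\<^sub>i\<close> reached by \<open>s\<^sub>i\<close> and \<open>X\<^sup>i\<^sub>R\<close> the set
  of states of \<open>G\<^sub>i\<close> that enable \<open>t\<^sub>i\<close>. The states of the composition that are reached by \<open>s\<close> and enable
  \<open>t\<close> are exactly the tuples in the product of the sets \<open>X\<^sup>i \<inter> X\<^sup>i\<^sub>R\<close>. So if all of them are secret
  for \<open>\<parallel>\<^sub>\<or>\<close>, then some factor \<open>X\<^sup>i \<inter> X\<^sup>i\<^sub>R\<close> lies in \<open>Q\<^sub>i\<^sup>S\<close>, the event \<open>\<psi>\<^sub>i\<close> is enabled, and
  it leads to a tuple with \<open>i\<close>-th component \<open>\<bottom>\<close>, from which no marked state can be reached.\<close>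

subsection \<open>Weak paths\<close>

lemma path_append: "path G p (s @ t) q \<longleftrightarrow> (\<exists>r. path G p s r \<and> path G r t q)"
  by (induction s arbitrary: p) auto

lemma delete_tau_simps [simp]:
  "delete_tau [] = []"
  "delete_tau (None # t) = delete_tau t"
  "delete_tau (Some a # t) = a # delete_tau t"
  "delete_tau (s @ t) = delete_tau s @ delete_tau t"
  "delete_tau (replicate k None) = []"
  "delete_tau (map Some u) = u"
  by (simp_all add: delete_tau_def filter_map comp_def)

lemma delete_tau_eq_Nil: "delete_tau t = [] \<Longrightarrow> t = replicate (length t) None"
  by (induction t) (auto simp: delete_tau_def split: if_splits)

text \<open>Deleting \<tau> keeps the order of the visible letters, so a cut of the visible word
  lifts to a cut of the full word. The construction puts the occurrences of \<open>None\<close> at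
  the cut into the second part.\<close>

lemma delete_tau_eq_append:
  "delete_tau u = s @ t \<Longrightarrow> \<exists>v w. u = v @ w \<and> delete_tau v = s \<and> delete_tau w = t"
proof (induction u arbitrary: s)
  case (Cons c u)
  show ?case
  proof (cases "s = []")
    case True
    then show ?thesis
      using Cons.prems by (intro exI[of _ "[]"] exI[of _ "c # u"]) simp
  next
    case False
    then obtain s' where s': "delete_tau u = s' @ t" "s = delete_tau [c] @ s'"
      using Cons.prems by (cases c) (auto simp: Cons_eq_append_conv)
    then obtain v w where "u = v @ w" "delete_tau v = s'" "delete_tau w = t"
      using Cons.IH by blast
    then show ?thesis
      using s'(2) by (intro exI[of _ "c # v"] exI[of _ w]) (cases c; simp)
  qed
qed simp

lemma delete_tau_rev: "delete_tau (rev t) = rev (delete_tau t)"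
  by (simp add: delete_tau_def rev_filter rev_map)

lemma weak_path_refl [simp]: "weak_path G p [] p"
  unfolding weak_path_def by (rule exI[of _ "[]"]) simp

lemma path_imp_weak_path: "path G p t q \<Longrightarrow> weak_path G p (delete_tau t) q"
  unfolding weak_path_def by blast

lemma weak_path_Some: "(p, Some \<sigma>, q) \<in> transitions G \<Longrightarrow> weak_path G p [\<sigma>] q"
  using path_imp_weak_path[of G p "[Some \<sigma>]" q] by simp

lemma weak_path_None: "(p, None, q) \<in> transitions G \<Longrightarrow> weak_path G p [] q"
  using path_imp_weak_path[of G p "[None]" q] by simp

lemma weak_path_append:
  "weak_path G p (s @ t) q \<longleftrightarrow> (\<exists>r. weak_path G p s r \<and> weak_path G r t q)"
proof
  assume "weak_path G p (s @ t) q"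
  then obtain u where "delete_tau u = s @ t" "path G p u q"
    unfolding weak_path_def by blast
  then show "\<exists>r. weak_path G p s r \<and> weak_path G r t q"
    using delete_tau_eq_append[of u s t] unfolding weak_path_def path_append[symmetric]
    by (metis path_append)
next
  assume "\<exists>r. weak_path G p s r \<and> weak_path G r t q"
  then show "weak_path G p (s @ t) q"
    unfolding weak_path_def by (metis path_append delete_tau_simps(4))
qed

lemma weak_path_trans: "weak_path G p s r \<Longrightarrow> weak_path G r t q \<Longrightarrow> weak_path G p (s @ t) q"
  using weak_path_append by metis

lemma weak_path_Nil_iff: "weak_path G p [] q \<longleftrightarrow> (\<exists>k. path G p (replicate k None) q)"
  unfolding weak_path_def by (metis delete_tau_eq_Nil delete_tau_simps(5))

text \<open>Induction along the path: leading \<tau>-moves are collected until the only visible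
  letter appears, and what follows it is invisible. This isolates the one transition on which
  components must synchronise.\<close>

lemma weak_path_single:
  "weak_path G p [\<sigma>] q \<longleftrightarrow>
     (\<exists>a b. weak_path G p [] a \<and> (a, Some \<sigma>, b) \<in> transitions G \<and> weak_path G b [] q)"
proof
  assume "weak_path G p [\<sigma>] q"
  then obtain u where "delete_tau u = [\<sigma>]" "path G p u q"
    unfolding weak_path_def by blast
  then show "\<exists>a b. weak_path G p [] a \<and> (a, Some \<sigma>, b) \<in> transitions G \<and> weak_path G b [] q"
  proof (induction u arbitrary: p)
    case (Cons c u)
    then obtain r where r: "(p, c, r) \<in> transitions G" "path G r u q"
      by auto
    show ?case
    proof (cases c)
      case None
      then obtain a b where "weak_path G r [] a" "(a, Some \<sigma>, b) \<in> transitions G" "weak_path G b [] q"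
        using Cons.IH[of r] Cons.prems(1) r(2) by auto
      moreover have "weak_path G p [] r"
        using r(1) None by (simp add: weak_path_None)
      ultimately show ?thesis
        using weak_path_trans[of G p "[]" r "[]"] by auto
    next
      case (Some d)
      then have "(p, Some \<sigma>, r) \<in> transitions G" "weak_path G r [] q"
        using Cons.prems(1) r(1) path_imp_weak_path[OF r(2)] by auto
      then show ?thesis
        by (intro exI[of _ p] exI[of _ r]) simp
    qed
  qed simp
next
  assume "\<exists>a b. weak_path G p [] a \<and> (a, Some \<sigma>, b) \<in> transitions G \<and> weak_path G b [] q"
  then show "weak_path G p [\<sigma>] q"
    using weak_path_Some weak_path_trans by (metis append_Nil append_Nil2)
qed

text \<open>The invariant that keeps runs inside the state set. It is separated from
  \<open>wf_automaton\<close> so that it alone is carried through \<open>det\<close>,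
  \<open>relabel\<close>, \<open>sync2\<close> and \<open>psi_automaton\<close>.\<close>

definition closed_automaton :: "('q, 'e) automaton \<Rightarrow> bool" where
  "closed_automaton G \<longleftrightarrow> transitions G \<subseteq> states G \<times> UNIV \<times> states G"

lemma wf_imp_closed_automaton: "wf_automaton G \<Longrightarrow> closed_automaton G"
  unfolding wf_automaton_def closed_automaton_def by blast

lemma path_in_states:
  "closed_automaton G \<Longrightarrow> path G p t q \<Longrightarrow> p \<in> states G \<Longrightarrow> q \<in> states G"
  by (induction t arbitrary: p) (auto simp: closed_automaton_def)

lemma weak_path_in_states:
  "closed_automaton G \<Longrightarrow> weak_path G p s q \<Longrightarrow> p \<in> states G \<Longrightarrow> q \<in> states G"
  unfolding weak_path_def using path_in_states by fast

lemma natural_projection_simps [simp]: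
  "natural_projection A [] = []"
  "natural_projection A (a # s) = (if a \<in> A then [a] else []) @ natural_projection A s"
  "natural_projection A (s @ t) = natural_projection A s @ natural_projection A t"
  by (auto simp: natural_projection_def)

lemma natural_projection_rev: "natural_projection A (rev s) = rev (natural_projection A s)"
  by (simp add: natural_projection_def rev_filter)

subsection \<open>Weak paths of a synchronous composition\<close>

text \<open>Component \<open>i\<close> stays put when the event is foreign to its alphabet or is a
  \<tau>-move of another component, and in these cases the projected word is empty. Writing
  \<open>delete_tau [a]\<close> treats visible and invisible moves alike.\<close>

lemma transition_sync_component:
  assumes "(x, a, y) \<in> transitions (sync I G)" "i \<in> I"
  shows "weak_path (G i) (x i) (natural_projection (events (G i)) (delete_tau [a])) (y i)"
  using assms by (fastforce simp: sync_def intro: weak_path_Some weak_path_None)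

lemma weak_path_sync_component:
  assumes "weak_path (sync I G) x s y" "i \<in> I"
  shows "weak_path (G i) (x i) (natural_projection (events (G i)) s) (y i)"
proof -
  have "weak_path (G i) (x i) (natural_projection (events (G i)) (delete_tau t)) (y i)"
    if "path (sync I G) x t y" for t
    using that
  proof (induction t arbitrary: x)
    case (Cons a t)
    then obtain r where "(x, a, r) \<in> transitions (sync I G)" "path (sync I G) r t y"
      by auto
    then have "weak_path (G i) (x i) (natural_projection (events (G i)) (delete_tau [a])
        @ natural_projection (events (G i)) (delete_tau t)) (y i)"
      using weak_path_trans transition_sync_component[OF _ assms(2)] Cons.IH by fast
    then show ?case
      by (cases a) auto
  qed simp
  then show ?thesis
    using assms(1) unfolding weak_path_def by blast
qed

lemma weak_path_sync_tau_update:
  assumes "\<And>i. i \<in> I \<Longrightarrow> closed_automaton (G i)"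
    and "x \<in> (\<Pi>\<^sub>E i\<in>I. states (G i))" "i \<in> I" "weak_path (G i) (x i) [] q"
  shows "weak_path (sync I G) x [] (x(i := q))"
proof -
  obtain k where "path (G i) (x i) (replicate k None) q"
    using assms(4) weak_path_Nil_iff by metis
  then show ?thesis
    using assms(2)
  proof (induction k arbitrary: x)
    case (Suc k)
    then obtain r where r: "(x i, None, r) \<in> transitions (G i)"
      "path (G i) r (replicate k None) q"
      by auto
    have t: "(x, None, x(i := r)) \<in> transitions (sync I G)"
      using r Suc.prems assms(3) by (auto simp: sync_def)
    have "x(i := r) \<in> (\<Pi>\<^sub>E i\<in>I. states (G i))"
      using r(1) assms(1)[OF assms(3)] Suc.prems(2) assms(3)
      by (auto simp: closed_automaton_def PiE_iff extensional_def)
    then have "weak_path (sync I G) (x(i := r)) [] ((x(i := r))(i := q))"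
      using r(2) Suc.IH[of "x(i := r)"] by (simp del: fun_upd_apply add: fun_upd_same)
    then show ?case
      using weak_path_trans[OF weak_path_None[OF t], of "[]" "x(i := q)"]
      by (simp del: fun_upd_apply)
  qed auto
qed

text \<open>Since \<tau> is never shared, the components can make their \<tau>-moves one after
  another, each changing one entry of the tuple.\<close>

lemma weak_path_sync_tau:
  assumes "finite I" "\<And>i. i \<in> I \<Longrightarrow> closed_automaton (G i)"
    and "x \<in> (\<Pi>\<^sub>E i\<in>I. states (G i))" "y \<in> (\<Pi>\<^sub>E i\<in>I. states (G i))"
    and "\<And>i. i \<in> I \<Longrightarrow> weak_path (G i) (x i) [] (y i)"
  shows "weak_path (sync I G) x [] y"
proof -
  \<comment> \<open>Generalised for induction: \<open>J\<close> contains all components in which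
    \<open>x\<close> still differs from \<open>y\<close>, and each step corrects one of
    them.\<close>
  have "weak_path (sync I G) x [] y"
    if "finite J" "J \<subseteq> I" "x \<in> (\<Pi>\<^sub>E i\<in>I. states (G i))"
      "\<forall>i\<in>I. weak_path (G i) (x i) [] (y i)" "\<forall>i\<in>I - J. x i = y i" for J x
    using that
  proof (induction J arbitrary: x rule: finite_induct)
    case empty
    then have "x = y"
      using assms(4) by (auto intro: PiE_ext)
    then show ?case by simp
  next
    case (insert j J)
    let ?z = "x(j := y j)"
    have "weak_path (sync I G) x [] ?z"
      using weak_path_sync_tau_update[OF assms(2) insert.prems(2), of j "y j"] insert.prems by auto
    moreover have "?z \<in> (\<Pi>\<^sub>E i\<in>I. states (G i))"
      using insert.prems assms(4) by (auto simp: PiE_iff extensional_def)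
    then have "weak_path (sync I G) ?z [] y"
      using insert by auto
    ultimately show ?case
      using weak_path_trans by fastforce
  qed
  from this[of I] show ?thesis
    using assms by auto
qed

text \<open>Converse of \<open>weak_path_sync_component\<close>: component runs that read the
  projections of one common word combine into a composed run, letter by letter.\<close>

lemma weak_path_syncI:
  assumes "finite I" "\<And>i. i \<in> I \<Longrightarrow> closed_automaton (G i)"
    and "x \<in> (\<Pi>\<^sub>E i\<in>I. states (G i))" "y \<in> (\<Pi>\<^sub>E i\<in>I. states (G i))"
    and "set s \<subseteq> (\<Union>i\<in>I. events (G i))"
    and "\<And>i. i \<in> I \<Longrightarrow> weak_path (G i) (x i) (natural_projection (events (G i)) s) (y i)"
  shows "weak_path (sync I G) x s y"
  using assms(3,5,6)
proof (induction s arbitrary: x)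
  case Nil
  then show ?case
    using weak_path_sync_tau[OF assms(1,2)] assms(4) by simp
next
  case (Cons \<sigma> s)
  \<comment> \<open>Each component moves invisibly to \<open>a\<close>, takes part in \<sigma> to
    reach \<open>b\<close>, and leaves the \<tau>-moves after \<sigma> to the rest of its run. A
    component without \<sigma> in its alphabet waits with \<open>a\<close> and \<open>b\<close> both
    equal to \<open>x i\<close>.\<close>
  have "\<exists>a b. weak_path (G i) (x i) [] a \<and>
      (if \<sigma> \<in> events (G i) then (a, Some \<sigma>, b) \<in> transitions (G i) else b = a) \<and>
      weak_path (G i) b (natural_projection (events (G i)) s) (y i)" if "i \<in> I" for i
  proof (cases "\<sigma> \<in> events (G i)")
    case True
    then have "weak_path (G i) (x i) ([\<sigma>] @ natural_projection (events (G i)) s) (y i)"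
      using Cons.prems(3)[OF that] by simp
    then obtain r where r: "weak_path (G i) (x i) [\<sigma>] r"
      "weak_path (G i) r (natural_projection (events (G i)) s) (y i)"
      using weak_path_append by metis
    then obtain a b where "weak_path (G i) (x i) [] a" "(a, Some \<sigma>, b) \<in> transitions (G i)"
      "weak_path (G i) b [] r"
      using weak_path_single by metis
    then show ?thesis
      using True r(2) weak_path_trans by (metis append_Nil)
  next
    case False
    then show ?thesis
      using Cons.prems(3)[OF that] by (auto intro!: exI[of _ "x i"])
  qed
  then obtain a b where ab: "\<And>i. i \<in> I \<Longrightarrow> weak_path (G i) (x i) [] (a i)"
    "\<And>i. i \<in> I \<Longrightarrow> if \<sigma> \<in> events (G i) then (a i, Some \<sigma>, b i) \<in> transitions (G i) else b i = a i"
    "\<And>i. i \<in> I \<Longrightarrow> weak_path (G i) (b i) (natural_projection (events (G i)) s) (y i)"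
    by metis
  \<comment> \<open>States of the composition are extensional functions, so the choice functions
    must be fixed outside \<open>I\<close>.\<close>
  let ?a = "restrict a I" and ?b = "restrict b I"
  have a_states: "a i \<in> states (G i)" if "i \<in> I" for i
    using weak_path_in_states[OF assms(2)[OF that] ab(1)[OF that]] Cons.prems(1) that by auto
  have b_states: "b i \<in> states (G i)" if "i \<in> I" for i
    using ab(2)[OF that] a_states[OF that] assms(2)[OF that]
    by (auto simp: closed_automaton_def split: if_splits)
  have "weak_path (sync I G) x [] ?a"
    using weak_path_sync_tau[OF assms(1,2) Cons.prems(1)] a_states ab(1) by simp
  moreover have "(?a, Some \<sigma>, ?b) \<in> transitions (sync I G)"
    using ab(2) a_states b_states Cons.prems(2) by (auto simp: sync_def)
  moreover have "weak_path (sync I G) ?b s y"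
    using Cons.prems(2) b_states ab(3) by (intro Cons.IH) auto
  ultimately show ?case
    using weak_path_trans[OF weak_path_trans[OF _ weak_path_Some]] by fastforce
qed

subsection \<open>Current-state estimates\<close>

text \<open>A description of the states of \<open>det G\<close> by weak paths, in place of iterating
  \<open>estimate_step\<close>. Applied to \<open>reversed G\<close>, it also describes the second
  half of the two-way observer.\<close>

definition estimate :: "('q, 'e) automaton \<Rightarrow> 'e list \<Rightarrow> 'q set" where
  "estimate G s = {q. \<exists>p\<in>initial G. weak_path G p s q}"

lemma wf_initial_subset: "wf_automaton G \<Longrightarrow> initial G \<subseteq> states G"
  by (simp add: wf_automaton_def)

lemma estimate_subset_states:
  assumes "wf_automaton G"
  shows "estimate G s \<subseteq> states G"
  using weak_path_in_states[OF wf_imp_closed_automaton[OF assms]] wf_initial_subset[OF assms]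
  by (auto simp: estimate_def)

lemma unobservable_reach_initial: "unobservable_reach G (initial G) = estimate G []"
  by (auto simp: unobservable_reach_def estimate_def weak_path_Nil_iff)

lemma mem_estimate_step_iff:
  "q \<in> estimate_step G X \<sigma> \<longleftrightarrow>
     (\<exists>x\<in>X. \<exists>y. (x, Some \<sigma>, y) \<in> transitions G \<and> weak_path G y [] q)"
proof -
  have "q \<in> unobservable_reach G {y} \<longleftrightarrow> weak_path G y [] q" for y
    by (simp add: unobservable_reach_def weak_path_Nil_iff)
  then show ?thesis
    unfolding estimate_step_def by blast
qed

text \<open>The \<tau>-moves before \<sigma> are absorbed into the run of \<open>s\<close>, which
  leaves exactly the shape of \<open>estimate_step\<close>: a visible transition followed by
  unobservable reach.\<close>

lemma weak_path_snoc:
  "weak_path G p (s @ [\<sigma>]) q \<longleftrightarrow>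
     (\<exists>x y. weak_path G p s x \<and> (x, Some \<sigma>, y) \<in> transitions G \<and> weak_path G y [] q)"
proof -
  have "weak_path G p s a" if "weak_path G p s r" "weak_path G r [] a" for r a
    using weak_path_trans[OF that] by simp
  then show ?thesis
    unfolding weak_path_append[of G p s "[\<sigma>]"] weak_path_single
    by (blast intro: weak_path_refl)
qed

lemma estimate_step_estimate: "estimate_step G (estimate G s) \<sigma> = estimate G (s @ [\<sigma>])"
  unfolding set_eq_iff mem_estimate_step_iff estimate_def weak_path_snoc by blast

text \<open>All states on a path from a reachable state are reachable, so the restriction removes
  none of its transitions.\<close>

lemma path_accessible_part:
  assumes "path G p t q" "p \<in> reachable G"
  shows "path (accessible_part G) p t q"
  using assms
proof (induction t arbitrary: p)
  case (Cons a t)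
  then obtain r where r: "(p, a, r) \<in> transitions G" "path G r t q"
    by auto
  obtain p0 u where "p0 \<in> initial G" "path G p0 u p"
    using Cons.prems(2) by (auto simp: reachable_def)
  then have "r \<in> reachable G"
    using r unfolding reachable_def by (auto intro!: bexI[of _ p0] exI[of _ "u @ [a]"] simp: path_append)
  then show ?case
    using Cons r by (auto simp: accessible_part_def)
qed simp

lemma path_det_estimate:
  assumes "wf_automaton G" "set s \<subseteq> events G" "estimate G s \<noteq> {}"
  shows "path (det G) (estimate G []) (map Some s) (estimate G s)"
  unfolding det_def
proof (rule path_accessible_part)
  let ?D = "\<lparr>events = events G, states = Pow (states G),
      transitions = {(X, Some \<sigma>, Y) | X \<sigma> Y.
        X \<subseteq> states G \<and> \<sigma> \<in> events G \<and> Y = estimate_step G X \<sigma> \<and> Y \<noteq> {}},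
      initial = {unobservable_reach G (initial G)}, marked = {}\<rparr>"
  show "estimate G [] \<in> reachable ?D"
    by (auto simp: reachable_def unobservable_reach_initial intro: exI[of _ "[]"])
  show "path ?D (estimate G []) (map Some s) (estimate G s)"
    using assms(2,3)
  proof (induction s rule: rev_induct)
    case (snoc \<sigma> s)
    \<comment> \<open>Transitions of \<open>det\<close> need nonempty targets; nonemptiness at the
      end of the word passes down to every prefix.\<close>
    have "estimate G s \<noteq> {}"
      using snoc.prems(2) by (auto simp: estimate_def weak_path_append)
    then have "path ?D (estimate G []) (map Some s) (estimate G s)"
      using snoc by simp
    moreover have "(estimate G s, Some \<sigma>, estimate G (s @ [\<sigma>])) \<in> transitions ?D"
      using snoc.prems estimate_subset_states[OF assms(1), of s]
      by (auto simp: estimate_step_estimate)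
    ultimately show ?case
      unfolding map_append path_append by auto
  qed simp
qed

lemma events_det [simp]: "events (det G) = events G"
  by (simp add: det_def accessible_part_def)

lemma initial_det: "initial (det G) = {estimate G []}"
  by (simp add: det_def accessible_part_def unobservable_reach_initial)

lemma estimate_step_subset_states:
  assumes "wf_automaton G"
  shows "estimate_step G X \<sigma> \<subseteq> states G"
  using weak_path_in_states[OF wf_imp_closed_automaton[OF assms]] wf_imp_closed_automaton[OF assms]
  unfolding closed_automaton_def subset_iff mem_estimate_step_iff by (metis mem_Sigma_iff)

lemma closed_det: "wf_automaton G \<Longrightarrow> closed_automaton (det G)"
  unfolding closed_automaton_def det_def accessible_part_def
  using estimate_step_subset_states by fastforce

lemma initial_det_subset: "wf_automaton G \<Longrightarrow> initial (det G) \<subseteq> states (det G)"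
  using estimate_subset_states[of G "[]"]
  by (auto simp: det_def accessible_part_def unobservable_reach_initial reachable_def
      intro: exI[of _ "[]"])

section \<open>Reversal and the states that enable a given word\<close>

lemma wf_reversed: "wf_automaton G \<Longrightarrow> wf_automaton (reversed G)"
  unfolding wf_automaton_def reversed_def by auto

lemma path_reversed: "path (reversed G) p t q \<longleftrightarrow> path G q (rev t) p"
  by (induction t arbitrary: p) (auto simp: path_append reversed_def)

lemma weak_path_reversed: "weak_path (reversed G) p s q \<longleftrightarrow> weak_path G q (rev s) p"
  unfolding weak_path_def path_reversed by (metis delete_tau_rev rev_rev_ident)

text \<open>A run of the reversed automaton reading \<open>rev t\<close> is a run of
  \<open>G\<close> reading \<open>t\<close>, traversed backwards. All states are initial in the
  reversal, so its estimate collects the states from which \<open>t\<close> can be executed.\<close>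

lemma estimate_reversed: "estimate (reversed G) (rev t) = {y. \<exists>z\<in>states G. weak_path G y t z}"
  by (simp add: estimate_def weak_path_reversed) (simp add: reversed_def)

subsection \<open>Two-way observers\<close>

lemma path_relabel: "path G p t q \<Longrightarrow> path (relabel f G) p (map (map_option f) t) q"
  by (induction t arbitrary: p) (auto simp: relabel_def)

lemma closed_relabel: "closed_automaton G \<Longrightarrow> closed_automaton (relabel f G)"
  by (auto simp: closed_automaton_def relabel_def)

lemma closed_sync2:
  "closed_automaton A \<Longrightarrow> closed_automaton B \<Longrightarrow> closed_automaton (sync2 A B)"
  by (auto simp: closed_automaton_def sync2_def)

lemma path_sync2_left:
  assumes "closed_automaton A" "path A x (map Some u) x'"
    and "set u \<subseteq> events A - events B" "y \<in> states B"
  shows "path (sync2 A B) (x, y) (map Some u) (x', y)"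
  using assms(2,3)
proof (induction u arbitrary: x)
  case (Cons \<sigma> u)
  then obtain r where r: "(x, Some \<sigma>, r) \<in> transitions A" "path A r (map Some u) x'"
    by auto
  then have "((x, y), Some \<sigma>, (r, y)) \<in> transitions (sync2 A B)"
    using Cons.prems assms(1,4) by (auto simp: sync2_def closed_automaton_def)
  then show ?case
    using Cons r by auto
qed simp

lemma path_sync2_right:
  assumes "closed_automaton B" "path B y (map Some u) y'"
    and "set u \<subseteq> events B - events A" "x \<in> states A"
  shows "path (sync2 A B) (x, y) (map Some u) (x, y')"
  using assms(2,3)
proof (induction u arbitrary: y)
  case (Cons \<sigma> u)
  then obtain r where r: "(y, Some \<sigma>, r) \<in> transitions B" "path B r (map Some u) y'"
    by auto
  then have "((x, y), Some \<sigma>, (x, r)) \<in> transitions (sync2 A B)"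
    using Cons.prems assms(1,4) by (auto simp: sync2_def closed_automaton_def)
  then show ?case
    using Cons r by auto
qed simp

lemma Delta_simps [simp]:
  "Delta a = Delta b \<longleftrightarrow> a = b" "Delta_R a = Delta_R b \<longleftrightarrow> a = b"
  "Delta a \<noteq> Delta_R b" "Delta_R b \<noteq> Delta a"
  by (auto simp: Delta_def Delta_R_def)

lemma events_two_way_observer:
  "events (two_way_observer G) = Delta ` events G \<union> Delta_R ` events G"
  unfolding two_way_observer_def by (simp add: sync2_def relabel_def) (simp add: reversed_def)

lemma closed_two_way_observer: "wf_automaton G \<Longrightarrow> closed_automaton (two_way_observer G)"
  unfolding two_way_observer_def
  by (intro closed_sync2 closed_relabel closed_det wf_reversed)

lemma initial_two_way_observer:
  "initial (two_way_observer G) = {(estimate G [], estimate (reversed G) [])}"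
  by (simp add: two_way_observer_def sync2_def relabel_def initial_det)

lemma initial_two_way_observer_subset:
  "wf_automaton G \<Longrightarrow> initial (two_way_observer G) \<subseteq> states (two_way_observer G)"
  using initial_det_subset[of G] initial_det_subset[OF wf_reversed]
  by (auto simp: two_way_observer_def sync2_def relabel_def)

text \<open>The images of \<open>Delta\<close> and \<open>Delta_R\<close> are disjoint, so the two
  estimators run independently: first the forward one while the other waits, then the backward
  one.\<close>

lemma path_two_way_observer:
  assumes "wf_automaton G" "set s \<subseteq> events G" "set t \<subseteq> events G"
    and "estimate G s \<noteq> {}" "estimate (reversed G) t \<noteq> {}"
  shows "path (two_way_observer G) (estimate G [], estimate (reversed G) [])
           (map Some (map Delta s @ map Delta_R t)) (estimate G s, estimate (reversed G) t)"
proof -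
  let ?A = "relabel Delta (det G)" and ?B = "relabel Delta_R (det (reversed G))"
  note wfR = wf_reversed[OF assms(1)]
  have events: "events ?A = Delta ` events G" "events ?B = Delta_R ` events G"
    by (simp_all add: relabel_def) (simp add: reversed_def)
  have A: "path ?A (estimate G []) (map Some (map Delta s)) (estimate G s)"
    using path_relabel[OF path_det_estimate[OF assms(1,2,4)], of Delta] by (simp add: comp_def)
  have B: "path ?B (estimate (reversed G) []) (map Some (map Delta_R t)) (estimate (reversed G) t)"
    using path_relabel[OF path_det_estimate[OF wfR _ assms(5)], of Delta_R] assms(3)
    by (simp add: comp_def reversed_def)
  have cA: "closed_automaton ?A" and cB: "closed_automaton ?B"
    using closed_relabel closed_det assms(1) wfR by blast+
  have B_init: "estimate (reversed G) [] \<in> states ?B"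
    using initial_det_subset[OF wfR] by (simp add: relabel_def initial_det)
  have A_init: "estimate G [] \<in> states ?A"
    using initial_det_subset[OF assms(1)] by (simp add: relabel_def initial_det)
  have "path (sync2 ?A ?B) (estimate G [], estimate (reversed G) []) (map Some (map Delta s))
      (estimate G s, estimate (reversed G) [])"
    using assms(2) by (intro path_sync2_left[OF cA A _ B_init]) (auto simp: events)
  moreover have "path (sync2 ?A ?B) (estimate G s, estimate (reversed G) [])
      (map Some (map Delta_R t)) (estimate G s, estimate (reversed G) t)"
    using assms(3) by (intro path_sync2_right[OF cB B _ path_in_states[OF cA A A_init]])
      (auto simp: events)
  ultimately show ?thesis
    unfolding two_way_observer_def map_append path_append by blast
qed

section \<open>\<psi>-automata over two-way observers\<close>

lemma psi_states_subset: "wf_automaton G \<Longrightarrow> psi_states K G QS \<subseteq> states (two_way_observer G)"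
  using path_in_states[OF closed_two_way_observer] initial_two_way_observer_subset
  unfolding psi_states_def by fast

lemma closed_psi_automaton:
  "closed_automaton D \<Longrightarrow> X \<subseteq> states D \<Longrightarrow> closed_automaton (psi_automaton D X p)"
  by (auto simp: closed_automaton_def psi_automaton_def)

lemma path_psi_automaton:
  "path D x t y \<Longrightarrow> path (psi_automaton D X p) (Some x) (map (map_option Inl) t) (Some y)"
proof (induction t arbitrary: x)
  case (Cons a t)
  then obtain r where r: "(x, a, r) \<in> transitions D" "path D r t y"
    by auto
  then have "(Some x, map_option Inl a, Some r) \<in> transitions (psi_automaton D X p)"
    by (auto simp: psi_automaton_def)
  then show ?case
    using Cons.IH[OF r(2)] by auto
qed simp

lemma weak_path_psi_automaton:
  assumes "path D x (map Some u) y"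
  shows "weak_path (psi_automaton D X p) (Some x) (map Inl u) (Some y)"
proof -
  have "map (map_option Inl) (map Some u) = map Some (map Inl u)"
    by simp
  then show ?thesis
    using path_imp_weak_path[OF path_psi_automaton[OF assms]] by (metis delete_tau_simps(6))
qed

text \<open>Coded letters belong to the alphabet of an observer exactly when the original letters
  belong to that of \<open>G\<close>, so coding commutes with projection. Hence all observers can
  read one common coded word.\<close>

lemma natural_projection_psi_automaton:
  "natural_projection (events (psi_automaton (two_way_observer G) X p))
     (map Inl (map Delta s @ map Delta_R t)) =
   map Inl (map Delta (natural_projection (events G) s) @ map Delta_R (natural_projection (events G) t))"
proof -
  have "Inl (Delta a) \<in> events (psi_automaton (two_way_observer G) X p) \<longleftrightarrow> a \<in> events G"
    "Inl (Delta_R a) \<in> events (psi_automaton (two_way_observer G) X p) \<longleftrightarrow> a \<in> events G" for a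
    by (auto simp: psi_automaton_def events_two_way_observer)
  then show ?thesis
    by (simp add: natural_projection_def filter_map comp_def)
qed

text \<open>The state \<open>None\<close> has no outgoing transition: an event in the alphabet of
  component \<open>i\<close> is blocked, and every other move leaves that component where it
  is.\<close>

lemma path_from_bottom:
  assumes "path (sync I (\<lambda>i. psi_automaton (D i) (X i) (p i))) x t y" "i \<in> I" "x i = None"
  shows "y i = None"
  using assms(1,3)
proof (induction t arbitrary: x)
  case (Cons a t)
  then obtain r where r: "(x, a, r) \<in> transitions (sync I (\<lambda>i. psi_automaton (D i) (X i) (p i)))"
    "path (sync I (\<lambda>i. psi_automaton (D i) (X i) (p i))) r t y"
    by auto
  have "(None, b, z) \<notin> transitions (psi_automaton (D i) (X i) (p i))" for b z
    by (auto simp: psi_automaton_def)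
  then have "r i = None"
    using r(1) Cons.prems(2) assms(2) by (fastforce simp: sync_def split: if_splits)
  then show ?case
    using Cons.IH r(2) by blast
qed simp

section \<open>From a nonblocking composition of observers to opacity\<close>

theorem theorem9:
  fixes K n :: nat
    and G :: "nat \<Rightarrow> ('q, 'e) automaton"
    and QS :: "nat \<Rightarrow> 'q set"
    and \<psi> :: "nat \<Rightarrow> 'p"
  assumes "n \<ge> 1"
    and "\<And>i. i \<in> {1..n} \<Longrightarrow> wf_automaton (G i)"
    and "\<And>i. i \<in> {1..n} \<Longrightarrow> QS i \<subseteq> states (G i)"
    and "inj_on \<psi> {1..n}"
    and "nonblocking (sync {1..n}
           (\<lambda>i. psi_automaton (two_way_observer (G i)) (psi_states K (G i) (QS i)) (\<psi> i)))"
  shows "k_step_opaque K (sync {1..n} G) (secret_or {1..n} G QS)"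
  unfolding k_step_opaque_def
proof (intro ballI impI, elim conjE)
  fix q0 s t
  let ?I = "{1..n}"
  let ?H = "\<lambda>i. psi_automaton (two_way_observer (G i)) (psi_states K (G i) (QS i)) (\<psi> i)"
  let ?P = "\<lambda>i. natural_projection (events (G i))"
  assume q0: "q0 \<in> initial (sync ?I G)"
    and s: "s \<in> lists (events (sync ?I G))" and t: "t \<in> lists (events (sync ?I G))"
    and st: "s @ t \<in> lang (sync ?I G) q0" and K: "length t \<le> K"
  define X where "X i = estimate (G i) (?P i s)" for i
  define R where "R i = estimate (reversed (G i)) (rev (?P i t))" for i
  have wf: "wf_automaton (G i)" and closed: "closed_automaton (G i)" if "i \<in> ?I" for i
    using assms(2)[OF that] wf_imp_closed_automaton by auto
  \<comment> \<open>The intermediate state \<open>y0\<close> is reached by \<open>s\<close> and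
    enables \<open>t\<close>, so each \<open>y0 i\<close> witnesses that
    \<open>X i \<inter> R i\<close> is nonempty.\<close>
  obtain y0 z0 where y0: "weak_path (sync ?I G) q0 s y0" and z0: "weak_path (sync ?I G) y0 t z0"
    using st by (auto simp: lang_def weak_path_append)
  have init: "q0 i \<in> initial (G i)" if "i \<in> ?I" for i
    using q0 that by (auto simp: sync_def)
  have y0X: "y0 i \<in> X i" if "i \<in> ?I" for i
    using weak_path_sync_component[OF y0 that] init[OF that] by (auto simp: X_def estimate_def)
  have X_states: "X i \<subseteq> states (G i)" if "i \<in> ?I" for i
    unfolding X_def using estimate_subset_states[OF wf[OF that]] .
  have y0R: "y0 i \<in> R i" if "i \<in> ?I" for i
    using weak_path_sync_component[OF z0 that] X_states[OF that] y0X[OF that]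
      weak_path_in_states[OF closed[OF that]]
    unfolding R_def estimate_reversed by blast
  have s_set: "set s \<subseteq> (\<Union>i\<in>?I. events (G i))" and t_set: "set t \<subseteq> (\<Union>i\<in>?I. events (G i))"
    using s t by (auto simp: sync_def)
  show "\<exists>q0'\<in>initial (sync ?I G). \<exists>y\<in>states (sync ?I G) - secret_or ?I G QS.
      weak_path (sync ?I G) q0' s y \<and> (\<exists>z. weak_path (sync ?I G) y t z)"
  proof (cases "\<forall>i\<in>?I. \<exists>y. y \<in> X i \<inter> R i \<and> y \<notin> QS i")
    case True
    then obtain y where y: "\<And>i. i \<in> ?I \<Longrightarrow> y i \<in> X i" "\<And>i. i \<in> ?I \<Longrightarrow> y i \<in> R i"
      "\<And>i. i \<in> ?I \<Longrightarrow> y i \<notin> QS i"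
      by (metis IntE)
    have "\<forall>i\<in>?I. \<exists>p. p \<in> initial (G i) \<and> weak_path (G i) p (?P i s) (y i)"
      using y(1) unfolding X_def estimate_def by blast
    then obtain p where p: "\<And>i. i \<in> ?I \<Longrightarrow> p i \<in> initial (G i)"
      "\<And>i. i \<in> ?I \<Longrightarrow> weak_path (G i) (p i) (?P i s) (y i)"
      by metis
    have "\<forall>i\<in>?I. \<exists>z. z \<in> states (G i) \<and> weak_path (G i) (y i) (?P i t) z"
      using y(2) unfolding R_def estimate_reversed by blast
    then obtain z where z: "\<And>i. i \<in> ?I \<Longrightarrow> z i \<in> states (G i)"
      "\<And>i. i \<in> ?I \<Longrightarrow> weak_path (G i) (y i) (?P i t) (z i)"
      by metis
    have y_states: "y i \<in> states (G i)" if "i \<in> ?I" for i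
      using X_states y(1) that by blast
    have p_states: "p i \<in> states (G i)" if "i \<in> ?I" for i
      using p(1)[OF that] wf[OF that] by (auto simp: wf_automaton_def)
    \<comment> \<open>The component runs were chosen independently; they combine because all of them
      read projections of the same \<open>s\<close>.\<close>
    have "weak_path (sync ?I G) (restrict p ?I) s (restrict y ?I)"
      using closed s_set y_states p_states p(2) by (intro weak_path_syncI) auto
    moreover have "weak_path (sync ?I G) (restrict y ?I) t (restrict z ?I)"
      using closed t_set y_states z by (intro weak_path_syncI) auto
    moreover have "restrict p ?I \<in> initial (sync ?I G)"
      using p(1) by (simp add: sync_def)
    moreover have "restrict y ?I \<in> states (sync ?I G) - secret_or ?I G QS"
      using y_states y(3) by (simp add: sync_def secret_or_def)
    ultimately show ?thesis
      by blast
  next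
    case False
    then obtain i where i: "i \<in> ?I" "X i \<inter> R i \<subseteq> QS i"
      by blast
    let ?w = "map Delta s @ map Delta_R (rev t)"
    define h0 where "h0 = (\<lambda>j\<in>?I. Some (estimate (G j) [], estimate (reversed (G j)) []))"
    define h where "h = (\<lambda>j\<in>?I. Some (X j, R j))"
    have closedH: "closed_automaton (?H j)" if "j \<in> ?I" for j
      by (intro closed_psi_automaton closed_two_way_observer psi_states_subset wf that)
    \<comment> \<open>The nonemptiness of both estimates, without which the estimators need not have
      these runs, comes from \<open>y0 j\<close>.\<close>
    have obs: "path (two_way_observer (G j)) (estimate (G j) [], estimate (reversed (G j)) [])
        (map Some (map Delta (?P j s) @ map Delta_R (rev (?P j t)))) (X j, R j)" if "j \<in> ?I" for j
      using path_two_way_observer[OF wf[OF that], of "?P j s" "rev (?P j t)"] y0X[OF that] y0R[OF that]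
      unfolding X_def R_def natural_projection_def by auto
    have h0_init: "h0 \<in> initial (sync ?I ?H)"
      by (simp add: h0_def sync_def psi_automaton_def initial_two_way_observer)
    have h0_states: "h0 j \<in> states (?H j)" if "j \<in> ?I" for j
      using initial_two_way_observer_subset[OF wf[OF that]] that
      by (simp add: h0_def psi_automaton_def initial_two_way_observer)
    have comp: "weak_path (?H j) (h0 j) (natural_projection (events (?H j)) (map Inl ?w)) (h j)"
      if "j \<in> ?I" for j
      using weak_path_psi_automaton[OF obs[OF that]] that
      unfolding natural_projection_psi_automaton natural_projection_rev h0_def h_def by simp
    have h_states: "h j \<in> states (?H j)" if "j \<in> ?I" for j
      using weak_path_in_states[OF closedH[OF that] comp[OF that] h0_states[OF that]] .
    have "weak_path (sync ?I ?H) h0 (map Inl ?w) h"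
    proof (rule weak_path_syncI)
      show "set (map Inl ?w) \<subseteq> (\<Union>j\<in>?I. events (?H j))"
        using s_set t_set
        by (fastforce simp: psi_automaton_def events_two_way_observer)
    qed (use closedH h0_states h_states comp in \<open>auto simp: h0_def h_def\<close>)
    then obtain u where u: "path (sync ?I ?H) h0 u h"
      unfolding weak_path_def by blast
    \<comment> \<open>Only the letters coded by \<open>Delta_R\<close> count, and projecting
      \<open>t\<close> to one alphabet does not lengthen it.\<close>
    have "length (natural_projection (Delta_R ` events (G i))
        (map Delta (?P i s) @ map Delta_R (rev (?P i t)))) \<le> K"
    proof -
      have "filter (\<lambda>e. e \<in> Delta_R ` events (G i)) (map Delta (?P i s)) = []"
        by (auto simp: filter_empty_conv)
      moreover have "length (filter (\<lambda>e. e \<in> events (G i)) t) \<le> K"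
        using le_trans[OF length_filter_le K] .
      ultimately show ?thesis
        by (simp add: natural_projection_def)
    qed
    moreover have "map Delta (?P i s) @ map Delta_R (rev (?P i t))
        \<in> lists (events (two_way_observer (G i)))"
      by (auto simp: events_two_way_observer natural_projection_def)
    ultimately have psi: "(X i, R i) \<in> psi_states K (G i) (QS i)"
      using obs[OF i(1)] i y0X y0R unfolding psi_states_def initial_two_way_observer by blast
    let ?b = "h(i := None)"
    have "(h, Some (Inr (\<psi> i)), ?b) \<in> transitions (sync ?I ?H)"
    proof -
      have "h \<in> (\<Pi>\<^sub>E j\<in>?I. states (?H j))"
        using h_states by (auto simp: h_def)
      moreover from this have "?b \<in> (\<Pi>\<^sub>E j\<in>?I. states (?H j))"
        using i(1) by (auto simp: PiE_iff extensional_def psi_automaton_def)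
      \<comment> \<open>Injectivity of \<psi> makes this event private to component
        \<open>i\<close>, so all other entries of \<open>h\<close> stay unchanged.\<close>
      moreover have "Inr (\<psi> i) \<in> events (?H j) \<longleftrightarrow> j = i" if "j \<in> ?I" for j
        using inj_on_eq_iff[OF assms(4) i(1) that] by (auto simp: psi_automaton_def)
      moreover have "(h i, Some (Inr (\<psi> i)), None) \<in> transitions (?H i)"
        using psi i(1) by (auto simp: h_def psi_automaton_def)
      ultimately show ?thesis
        using i(1) by (auto simp: sync_def)
    qed
    then have "path (sync ?I ?H) h0 (u @ [Some (Inr (\<psi> i))]) ?b"
      using u by (auto simp: path_append)
    then have "?b \<in> reachable (sync ?I ?H)"
      using h0_init unfolding reachable_def by blast
    \<comment> \<open>Nonblocking supplies a marked tuple, yet its entry at \<open>i\<close> is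
      still \<open>None\<close>, which is unmarked: a contradiction.\<close>
    then obtain m v where m: "m \<in> marked (sync ?I ?H)" "path (sync ?I ?H) ?b v m"
      using assms(5) unfolding nonblocking_def by blast
    then have "m i = None"
      using path_from_bottom[OF m(2) i(1)] by simp
    moreover have "m i \<in> marked (?H i)"
      using m(1) i(1) by (auto simp: sync_def)
    ultimately show ?thesis
      by (auto simp: psi_automaton_def)
  qed
qed

end
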